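(* Let $\Phi=\bigwedge_{j=1}^m\Psi_j$ be a 3-cnf formula with $m\ge 1$ disjunctive clauses over the variables $V_1,\dots,V_k$, and let $\bar S_\Phi,\bar T_\Phi$ be the time series over $\mathbb R^k$ constructed from $\Phi$ as described in the context. Then $\Phi$ has a 1-in-3 model if and only if $d_1^C(\bar S_\Phi,\bar T_\Phi)=m\cdot(72+8\sqrt2)$.
   Context: A 3-cnf formula is a conjunction $\Phi=\bigwedge_{j=1}^m\Psi_j$ of disjunctive 3-clauses $\Psi=\bigvee_{i\in I}L_i$ with $I\subseteq[1,k]$, $|I|=3$, and each literal $L_i\in\{V_i,\neg V_i\}$. A 1-in-3 model of $\Phi$ is an assignment of truth values 0/1 to the variables such that in every clause exactly one literal is satisfied. Let $e_i$ be the $i$-th unit vector of $\mathbb R^k$. For a literal put $l_i=e_i$ if $L_i=V_i$ and $l_i=-e_i$ if $L_i=\neg V_i$. For a clause $\Psi=\bigvee_{i\in I}L_i$ with $I=\{i_1<i_2<i_3\}$ define $\gamma_j=l_j-\sum_{i\in I\setminus\{j\}}l_i$ for $j\in I$, and $e_I=\sum_{i\in I}e_i$. Define the time series (sequences of vectors in $\mathbb R^k$) $S'_\Psi=(6e_{i_1},-6e_{i_1},6e_{i_2},-6e_{i_2},6e_{i_3},-6e_{i_3})$, $T'_\Psi=(6e_{i_1},6e_{i_1},6e_{i_2},6e_{i_2},6e_{i_3},6e_{i_3})$, $S_\Psi=(\gamma_{i_1},\gamma_{i_2},\gamma_{i_3})$, $T_\Psi=(e_I,e_I,e_I)$, $\tilde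 S_\Psi$ = concatenation of $S'_\Psi$ followed by $S_\Psi$, and $\tilde T_\Psi$ = concatenation of $T'_\Psi$ followed by $T_\Psi$. Let $S_\Phi$ be the concatenation $\tilde S_{\Psi_1},\dots,\tilde S_{\Psi_m}$ and $T_\Phi$ the concatenation $\tilde T_{\Psi_1},\dots,\tilde T_{\Psi_m}$. Finally $\bar S_\Phi$ is $S_\Phi$ followed by $-S_\Phi$ (all states negated), and $\bar T_\Phi$ is $T_\Phi$ followed by $-T_\Phi$. For equal-length time series $S=(s_i),T=(t_i)$, $d_1(S,T)=\sum_i\|s_i-t_i\|_2$; $\mathcal{MO}(k)$ is the set of real orthogonal $k\times k$ matrices; $M\cdot T+v=(Mt_i+v)_i$; and $d_1^C(S,T)=\min_{M\in\mathcal{MO}(k),v\in\mathbb R^k}d_1(S,M\cdot T+v)$. *)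

theory Defs
  imports "HOL-Analysis.Analysis"
begin

text \<open>The variables are indexed by a finite linearly ordered type \<open>'n\<close>, so that \<open>k\<close> is
  \<open>CARD('n)\<close> and the Euclidean space is \<open>real ^ 'n\<close>.\<close>

datatype 'n literal = Pos 'n | Neg 'n

text \<open>The pair \<open>(I, L)\<close> stands for the disjunction of the literals \<open>L i\<close> with \<open>i \<in> I\<close>; the values
  of \<open>L\<close> outside \<open>I\<close> are irrelevant.\<close>

type_synonym 'n clause = "'n set \<times> ('n \<Rightarrow> 'n literal)"

type_synonym 'n cnf = "'n clause list"

definition is_3clause :: "'n clause \<Rightarrow> bool" where
  "is_3clause = (\<lambda>(I, L). card I = 3 \<and> (\<forall>i\<in>I. L i \<in> {Pos i, Neg i}))"

definition is_3cnf :: "'n cnf \<Rightarrow> bool" where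
  "is_3cnf \<Phi> \<longleftrightarrow> (\<forall>\<Psi>\<in>set \<Phi>. is_3clause \<Psi>)"

fun satisfies :: "('n \<Rightarrow> bool) \<Rightarrow> 'n literal \<Rightarrow> bool" where
  "satisfies a (Pos i) \<longleftrightarrow> a i"
| "satisfies a (Neg i) \<longleftrightarrow> \<not> a i"

definition one_in_three_model :: "('n \<Rightarrow> bool) \<Rightarrow> 'n cnf \<Rightarrow> bool" where
  "one_in_three_model a \<Phi> \<longleftrightarrow> (\<forall>(I, L)\<in>set \<Phi>. \<exists>!i. i \<in> I \<and> satisfies a (L i))"

type_synonym 'n time_series = "(real ^ 'n) list"

abbreviation unit_vec :: "'n::finite \<Rightarrow> real ^ 'n" where
  "unit_vec i \<equiv> axis i 1"

fun lit_vec :: "'n::finite literal \<Rightarrow> real ^ 'n" where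
  "lit_vec (Pos i) = unit_vec i"
| "lit_vec (Neg i) = - unit_vec i"

definition gamma :: "'n::finite clause \<Rightarrow> 'n \<Rightarrow> real ^ 'n" where
  "gamma = (\<lambda>(I, L) j. lit_vec (L j) - (\<Sum>i\<in>I - {j}. lit_vec (L i)))"

definition clause_S' :: "'n::{finite,linorder} clause \<Rightarrow> 'n time_series" where
  "clause_S' = (\<lambda>(I, L).
     concat (map (\<lambda>i. [6 *\<^sub>R unit_vec i, (-6) *\<^sub>R unit_vec i]) (sorted_list_of_set I)))"

definition clause_T' :: "'n::{finite,linorder} clause \<Rightarrow> 'n time_series" where
  "clause_T' = (\<lambda>(I, L).
     concat (map (\<lambda>i. [6 *\<^sub>R unit_vec i, 6 *\<^sub>R unit_vec i]) (sorted_list_of_set I)))"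

definition clause_S :: "'n::{finite,linorder} clause \<Rightarrow> 'n time_series" where
  "clause_S = (\<lambda>(I, L). map (gamma (I, L)) (sorted_list_of_set I))"

definition clause_T :: "'n::{finite,linorder} clause \<Rightarrow> 'n time_series" where
  "clause_T = (\<lambda>(I, L). replicate 3 (\<Sum>i\<in>I. unit_vec i))"

definition clause_S_tilde :: "'n::{finite,linorder} clause \<Rightarrow> 'n time_series" where
  "clause_S_tilde \<Psi> = clause_S' \<Psi> @ clause_S \<Psi>"

definition clause_T_tilde :: "'n::{finite,linorder} clause \<Rightarrow> 'n time_series" where
  "clause_T_tilde \<Psi> = clause_T' \<Psi> @ clause_T \<Psi>"

definition formula_S :: "'n::{finite,linorder} cnf \<Rightarrow> 'n time_series" where
  "formula_S \<Phi> = concat (map clause_S_tilde \<Phi>)"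

definition formula_T :: "'n::{finite,linorder} cnf \<Rightarrow> 'n time_series" where
  "formula_T \<Phi> = concat (map clause_T_tilde \<Phi>)"

definition formula_S_bar :: "'n::{finite,linorder} cnf \<Rightarrow> 'n time_series" where
  "formula_S_bar \<Phi> = formula_S \<Phi> @ map uminus (formula_S \<Phi>)"

definition formula_T_bar :: "'n::{finite,linorder} cnf \<Rightarrow> 'n time_series" where
  "formula_T_bar \<Phi> = formula_T \<Phi> @ map uminus (formula_T \<Phi>)"

text \<open>Only meaningful for time series of equal length.\<close>

definition d1 :: "'n::finite time_series \<Rightarrow> 'n time_series \<Rightarrow> real" where
  "d1 S T = (\<Sum>i<length S. norm (S ! i - T ! i))"

definition congruent_image ::
  "real ^ 'n ^ 'n \<Rightarrow> real ^ 'n \<Rightarrow> 'n::finite time_series \<Rightarrow> 'n time_series" where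
  "congruent_image M v T = map (\<lambda>t. M *v t + v) T"

text \<open>The infimum is a minimum: see \<open>d1C_attained\<close> and \<open>d1C_le\<close>.\<close>

definition d1C :: "'n::finite time_series \<Rightarrow> 'n time_series \<Rightarrow> real" where
  "d1C S T = Inf {d1 S (congruent_image M v T) | M v. orthogonal_matrix M}"

lemma length_clause_tilde:
  assumes "is_3clause \<Psi>"
  shows "length (clause_S_tilde \<Psi>) = 9" "length (clause_T_tilde \<Psi>) = 9"
  using assms
  by (auto simp: is_3clause_def clause_S_tilde_def clause_T_tilde_def clause_S'_def clause_T'_def
      clause_S_def clause_T_def length_concat o_def sum_list_triv split: prod.splits)

lemma length_formula_bar:
  assumes "is_3cnf \<Phi>"
  shows "length (formula_S_bar \<Phi>) = 18 * length \<Phi>" "length (formula_T_bar \<Phi>) = 18 * length \<Phi>"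
proof -
  have "length (formula_S \<Phi>) = 9 * length \<Phi>" "length (formula_T \<Phi>) = 9 * length \<Phi>"
    using assms
    by (induction \<Phi>) (auto simp: is_3cnf_def formula_S_def formula_T_def length_clause_tilde)
  then show "length (formula_S_bar \<Phi>) = 18 * length \<Phi>" "length (formula_T_bar \<Phi>) = 18 * length \<Phi>"
    by (simp_all add: formula_S_bar_def formula_T_bar_def)
qed

lemma d1_nonneg: "0 \<le> d1 S T"
  by (simp add: d1_def sum_nonneg)

lemma d1C_le:
  assumes "orthogonal_matrix M"
  shows "d1C S T \<le> d1 S (congruent_image M v T)"
  unfolding d1C_def
  by (rule cInf_lower) (use assms in \<open>auto intro!: bdd_belowI[where m = 0] d1_nonneg\<close>)

lemma compact_orthogonal_matrices:
  "compact {M :: real ^ 'n ^ 'n. orthogonal_matrix M}"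
proof -
  have "continuous_on UNIV (\<lambda>M :: real ^ 'n ^ 'n. transpose M ** M)"
    unfolding matrix_matrix_mult_def transpose_def by (intro continuous_intros)
  then have "closed {M :: real ^ 'n ^ 'n. transpose M ** M = mat 1}"
    by (intro closed_Collect_eq continuous_intros)
  moreover have "norm M \<le> real CARD('n)" if "orthogonal_matrix M" for M :: "real ^ 'n ^ 'n"
  proof -
    have "norm M \<le> (\<Sum>i\<in>UNIV. norm (M $ i))"
      unfolding norm_vec_def[of M] by (rule L2_set_le_sum) simp
    also have "\<dots> = (\<Sum>i\<in>(UNIV :: 'n set). 1)"
      using that by (simp add: orthogonal_matrix_orthonormal_rows row_def)
    finally show ?thesis by simp
  qed
  ultimately show ?thesis
    by (auto simp: compact_eq_bounded_closed bounded_iff simp flip: orthogonal_matrix)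
qed

lemma d1C_attained:
  fixes S T :: "'n::finite time_series"
  assumes len: "length S = length T"
  obtains M v where "orthogonal_matrix M" "d1C S T = d1 S (congruent_image M v T)"
proof -
  define f where "f p = d1 S (congruent_image (fst p) (snd p) T)" for p :: "(real^'n^'n) \<times> (real^'n)"
  have f_eq: "f p = (\<Sum>i<length S. norm (S ! i - (fst p *v T ! i + snd p)))" for p
    unfolding f_def d1_def congruent_image_def by (simp add: len)
  have "\<exists>p. orthogonal_matrix (fst p) \<and> (\<forall>q. orthogonal_matrix (fst q) \<longrightarrow> f p \<le> f q)"
  proof (cases "S = []")
    case True
    then show ?thesis
      by (intro exI[of _ "(mat 1, 0)"]) (simp add: f_eq orthogonal_matrix_id)
  next
    case False
    define R where "R = f (mat 1, 0) + norm (S ! 0) + norm (T ! 0)"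
    define K where "K = {M :: real^'n^'n. orthogonal_matrix M} \<times> cball (0 :: real^'n) R"
    have "compact K"
      unfolding K_def by (intro compact_Times compact_orthogonal_matrices compact_cball)
    moreover have "0 \<le> R"
      unfolding R_def f_def by (simp add: d1_nonneg)
    then have id_in: "(mat 1, 0) \<in> K"
      by (simp add: K_def orthogonal_matrix_id)
    moreover have "continuous_on K f"
      unfolding f_eq matrix_vector_mult_def by (intro continuous_intros)
    ultimately obtain p where p: "p \<in> K" "\<And>q. q \<in> K \<Longrightarrow> f p \<le> f q"
      using continuous_attains_inf[of K f] by blast
    have "f p \<le> f q" if orth: "orthogonal_matrix (fst q)" for q
    proof (cases "q \<in> K")
      case False
      then have "R < norm (snd q)"
        using orth by (cases q) (auto simp: K_def)
      moreover have "norm (fst q *v T ! 0) = norm (T ! 0)"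
        using orth orthogonal_transformation_matrix[of "(*v) (fst q)"]
        by (simp add: orthogonal_transformation)
      moreover have "norm (S ! 0 - (fst q *v T ! 0 + snd q)) \<le> f q"
        unfolding f_eq using \<open>S \<noteq> []\<close> by (intro member_le_sum) auto
      moreover have "norm (snd q) \<le>
          norm (S ! 0 - (fst q *v T ! 0 + snd q)) + norm (S ! 0) + norm (fst q *v T ! 0)"
        by norm
      ultimately have "f (mat 1, 0) \<le> f q"
        by (simp add: R_def)
      then show ?thesis
        using p(2)[OF id_in] by linarith
    qed (use p in auto)
    moreover have "orthogonal_matrix (fst p)"
      using p(1) by (auto simp: K_def)
    ultimately show ?thesis
      by blast
  qed
  then obtain p where p: "orthogonal_matrix (fst p)"
    "\<And>q. orthogonal_matrix (fst q) \<Longrightarrow> f p \<le> f q"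
    by blast
  have "d1C S T = d1 S (congruent_image (fst p) (snd p) T)"
    unfolding d1C_def
  proof (rule cInf_eq_minimum)
    fix x assume "x \<in> {d1 S (congruent_image M v T) |M v. orthogonal_matrix M}"
    then obtain M v where "x = f (M, v)" "orthogonal_matrix M"
      by (auto simp: f_def)
    then show "d1 S (congruent_image (fst p) (snd p) T) \<le> x"
      using p(2)[of "(M, v)"] by (simp add: f_def)
  qed (use p(1) in auto)
  with p(1) show ?thesis
    by (rule that)
qed

end

theory Submission
  imports Defs
begin

text \<open>Appending the negated series makes the optimal translation zero. Rounding each \<open>M e\<^sub>i\<close>
  to the nearer of \<open>e\<^sub>i\<close> and \<open>-e\<^sub>i\<close>, at distance \<open>a\<^sub>i\<close>, changes the cost of the three states
  \<open>\<gamma>\<^sub>j\<close> of a clause by at most \<open>3 \<Sum> a\<^sub>i\<close>, while the states \<open>\<plusminus>6 e\<^sub>i\<close> charge at least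
  \<open>12 + 3 a\<^sub>i\<close> for each variable of the clause. Hence the cost of \<open>M\<close> is at least the cost of a
  diagonal sign matrix, that is, of an assignment. For an assignment the distance from \<open>\<gamma>\<^sub>j\<close> is
  twice the square root of the number of differing signs, and among the four possible numbers of
  satisfied literals only one satisfied literal gives the minimum \<open>4 sqrt 2\<close>.\<close>

definition truth_sign :: "bool \<Rightarrow> real" where
  "truth_sign b = (if b then 1 else -1)"

text \<open>This is the image of the vector \<Sum> e_i over \<open>I\<close> under the diagonal
  matrix with the signs of \<open>a\<close>.\<close>

definition assignment_vec :: "('n \<Rightarrow> bool) \<Rightarrow> 'n set \<Rightarrow> real ^ 'n::finite" where
  "assignment_vec a I = (\<Sum>i\<in>I. truth_sign (a i) *\<^sub>R unit_vec i)"

definition clause_sign_cost :: "('n \<Rightarrow> bool) \<Rightarrow> 'n::finite clause \<Rightarrow> real" where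
  "clause_sign_cost a = (\<lambda>(I, L). \<Sum>j\<in>I. norm (gamma (I, L) j - assignment_vec a I))"

text \<open>A sixth of what the states 6 e_i and -6 e_i cost when both are matched with 6 M
  e_i.\<close>

definition axis_cost :: "real ^ 'n ^ 'n \<Rightarrow> 'n::finite \<Rightarrow> real" where
  "axis_cost M i = norm (unit_vec i - M *v unit_vec i) + norm (unit_vec i + M *v unit_vec i)"

definition clause_cost :: "real ^ 'n ^ 'n \<Rightarrow> 'n::finite clause \<Rightarrow> real" where
  "clause_cost M = (\<lambda>(I, L). 6 * (\<Sum>i\<in>I. axis_cost M i) +
     (\<Sum>j\<in>I. norm (gamma (I, L) j - M *v (\<Sum>i\<in>I. unit_vec i))))"

section \<open>Concatenation, and elimination of the translation\<close>

lemma d1_Nil [simp]: "d1 [] T = 0"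
  by (simp add: d1_def)

lemma d1_Cons [simp]: "d1 (s # S) (t # T) = norm (s - t) + d1 S T"
  by (simp add: d1_def sum.lessThan_Suc_shift del: sum.lessThan_Suc)

lemma d1_append:
  assumes "length S = length T"
  shows "d1 (S @ S') (T @ T') = d1 S T + d1 S' T'"
  using assms by (induction S T rule: list_induct2) auto

lemma congruent_image_simps [simp]:
  "congruent_image M v [] = []"
  "congruent_image M v (t # T) = (M *v t + v) # congruent_image M v T"
  "congruent_image M v (T @ T') = congruent_image M v T @ congruent_image M v T'"
  "length (congruent_image M v T) = length T"
  by (simp_all add: congruent_image_def)

lemma matrix_vector_mult_uminus: "M *v (- x) = - (M *v x)" for M :: "real ^ 'n ^ 'm"
  using matrix_vector_mult_diff_distrib[of M 0 x] by simp

text \<open>The vector \<open>v\<close> cancels in the difference of the two arguments on the right,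
  which is 2 \<open>x\<close>.\<close>

lemma two_norm_le_norm_add_norm:
  fixes x v :: "'a::real_normed_vector"
  shows "2 * norm x \<le> norm (x - v) + norm (- x - v)"
proof -
  have "norm (2 *\<^sub>R x) \<le> norm (x - v) + norm (- x - v)"
    using norm_triangle_ineq4[of "x - v" "- x - v"] by (simp add: scaleR_2)
  then show ?thesis by simp
qed

text \<open>Negating a pair of states flips \<open>s - M *v t\<close> but leaves \<open>v\<close> as
  it is, so each pair together with its negated copy costs least when \<open>v\<close> is
  zero.\<close>

lemma d1_symmetrized_ge:
  assumes "length S = length T"
  shows "2 * d1 S (congruent_image M 0 T) \<le>
    d1 (S @ map uminus S) (congruent_image M v (T @ map uminus T))"
proof -
  have "2 * d1 S (congruent_image M 0 T) \<le>
    d1 S (congruent_image M v T) + d1 (map uminus S) (congruent_image M v (map uminus T))"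
    using assms
  proof (induction S T rule: list_induct2)
    case (Cons s S t T)
    have "2 * norm (s - M *v t) \<le> norm (s - (M *v t + v)) + norm (- s - (- (M *v t) + v))"
      using two_norm_le_norm_add_norm[of "s - M *v t" v] by (simp add: algebra_simps)
    with Cons show ?case by (simp add: matrix_vector_mult_uminus)
  qed simp
  with assms show ?thesis by (simp add: d1_append)
qed

lemma d1_symmetrized_eq:
  assumes "length S = length T"
  shows "d1 (S @ map uminus S) (congruent_image M 0 (T @ map uminus T)) =
    2 * d1 S (congruent_image M 0 T)"
proof -
  have "d1 (map uminus S) (congruent_image M 0 (map uminus T)) = d1 S (congruent_image M 0 T)"
    using assms
  proof (induction S T rule: list_induct2)
    case (Cons s S t T)
    then show ?case
      by (simp add: matrix_vector_mult_uminus norm_minus_commute)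
  qed simp
  with assms show ?thesis by (simp add: d1_append)
qed

section \<open>Splitting the cost into contributions of the clauses\<close>

lemma is_3clause_cases:
  fixes \<Psi> :: "'n::{finite,linorder} clause"
  assumes "is_3clause \<Psi>"
  obtains x y z L where "\<Psi> = ({x, y, z}, L)" "sorted_list_of_set {x, y, z} = [x, y, z]"
    "x \<noteq> y" "x \<noteq> z" "y \<noteq> z" "\<And>i. i \<in> {x, y, z} \<Longrightarrow> L i \<in> {Pos i, Neg i}"
proof -
  obtain I L where \<Psi>: "\<Psi> = (I, L)" by (cases \<Psi>)
  with assms have I: "card I = 3" "\<And>i. i \<in> I \<Longrightarrow> L i \<in> {Pos i, Neg i}"
    by (auto simp: is_3clause_def)
  have "length (sorted_list_of_set I) = Suc (Suc (Suc 0))" using I by simp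
  then obtain x y z where xyz: "sorted_list_of_set I = [x, y, z]"
    by (auto simp only: length_Suc_conv length_0_conv)
  have "set (sorted_list_of_set I) = I" "distinct (sorted_list_of_set I)" by auto
  with xyz have "I = {x, y, z}" "x \<noteq> y" "x \<noteq> z" "y \<noteq> z" by auto
  then show thesis using that \<Psi> I xyz by blast
qed

lemma d1_clause_tilde:
  fixes \<Psi> :: "'n::{finite,linorder} clause"
  assumes "is_3clause \<Psi>"
  shows "d1 (clause_S_tilde \<Psi>) (congruent_image M 0 (clause_T_tilde \<Psi>)) = clause_cost M \<Psi>"
  using assms
proof (cases rule: is_3clause_cases)
  case (1 x y z L)
  have axis: "norm (6 *\<^sub>R unit_vec i - M *v (6 *\<^sub>R unit_vec i)) +
      norm ((-6) *\<^sub>R unit_vec i - M *v (6 *\<^sub>R unit_vec i)) = 6 * axis_cost M i" for i :: 'n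
  proof -
    have "6 *\<^sub>R unit_vec i - M *v (6 *\<^sub>R unit_vec i) = 6 *\<^sub>R (unit_vec i - M *v unit_vec i)"
      "(-6) *\<^sub>R unit_vec i - M *v (6 *\<^sub>R unit_vec i) = (-6) *\<^sub>R (unit_vec i + M *v unit_vec i)"
      by (simp_all add: algebra_simps matrix_vector_mult_scaleR)
    then show ?thesis by (simp only: norm_scaleR axis_cost_def) simp
  qed
  show ?thesis
    using 1(3-5) axis[of x] axis[of y] axis[of z]
    by (simp add: 1(1,2) clause_S_tilde_def clause_T_tilde_def clause_S'_def clause_T'_def
        clause_S_def clause_T_def clause_cost_def numeral_3_eq_3 del: scaleR_minus_left)
qed

lemma length_formula_S_T:
  assumes "is_3cnf \<Phi>"
  shows "length (formula_S \<Phi>) = length (formula_T \<Phi>)"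
  using assms
  by (induction \<Phi>) (auto simp: is_3cnf_def formula_S_def formula_T_def length_clause_tilde)

lemma d1_formula:
  assumes "is_3cnf \<Phi>"
  shows "d1 (formula_S \<Phi>) (congruent_image M 0 (formula_T \<Phi>)) = (\<Sum>\<Psi>\<leftarrow>\<Phi>. clause_cost M \<Psi>)"
  using assms
proof (induction \<Phi>)
  case (Cons \<Psi> \<Phi>)
  then have "is_3clause \<Psi>" "is_3cnf \<Phi>" by (auto simp: is_3cnf_def)
  with Cons.IH show ?case
    by (simp add: formula_S_def formula_T_def d1_append length_clause_tilde d1_clause_tilde)
qed (simp add: formula_S_def)

section \<open>The cost of an assignment\<close>

lemma norm_sum_scaled_axes:
  fixes c :: "'n::finite \<Rightarrow> real"
  shows "norm (\<Sum>i\<in>I. c i *\<^sub>R unit_vec i) = sqrt (\<Sum>i\<in>I. (c i)\<^sup>2)"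
proof -
  have "(\<Sum>i\<in>I. c i *\<^sub>R unit_vec i) $ k = (if k \<in> I then c k else 0)" for k
    by (simp add: axis_def if_distrib cong: if_cong)
  then show ?thesis
    by (simp add: norm_vec_def L2_set_def if_distrib[of "\<lambda>x. x\<^sup>2"] sum.If_cases cong: if_cong)
qed

text \<open>The left side does not depend on \<open>a\<close>: under every assignment, a literal is
  positive exactly when its truth value agrees with that of its variable. This form allows
  comparison with the signs of \<open>a\<close>.\<close>

lemma lit_vec_eq:
  assumes "l \<in> {Pos i, Neg i}"
  shows "lit_vec l = truth_sign (satisfies a l = a i) *\<^sub>R unit_vec i"
  using assms by (auto simp: truth_sign_def)

text \<open>Both vectors have entries 1 or -1 on \<open>I\<close>, so their difference has entries
  0, 2 or -2. It is nonzero at \<open>j\<close> when the literal there is false, and at any other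
  index when the literal there is true.\<close>

lemma norm_gamma_diff_assignment_vec:
  fixes L :: "'n::finite \<Rightarrow> 'n literal"
  assumes "j \<in> I" and L: "\<And>i. i \<in> I \<Longrightarrow> L i \<in> {Pos i, Neg i}"
  shows "norm (gamma (I, L) j - assignment_vec a I) =
    2 * sqrt (of_bool (\<not> satisfies a (L j)) + (\<Sum>i\<in>I - {j}. of_bool (satisfies a (L i))))"
proof -
  define s where "s i = truth_sign (satisfies a (L i) = a i)" for i
  define c where "c i = (if i = j then s i else - s i) - truth_sign (a i)" for i
  have "(\<Sum>i\<in>I - {j}. lit_vec (L i)) = (\<Sum>i\<in>I - {j}. s i *\<^sub>R unit_vec i)"
    unfolding s_def by (intro sum.cong refl lit_vec_eq) (use L in auto)
  moreover have "lit_vec (L j) = s j *\<^sub>R unit_vec j"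
    unfolding s_def by (intro lit_vec_eq) (use assms in auto)
  ultimately have "gamma (I, L) j - assignment_vec a I =
      (s j *\<^sub>R unit_vec j - (\<Sum>i\<in>I - {j}. s i *\<^sub>R unit_vec i)) -
      (truth_sign (a j) *\<^sub>R unit_vec j + (\<Sum>i\<in>I - {j}. truth_sign (a i) *\<^sub>R unit_vec i))"
    using \<open>j \<in> I\<close> by (simp add: gamma_def assignment_vec_def sum.remove[of I j])
  also have "\<dots> = c j *\<^sub>R unit_vec j + (\<Sum>i\<in>I - {j}. c i *\<^sub>R unit_vec i)"
    by (simp add: c_def algebra_simps sum.distrib sum_subtractf sum_negf)
  also have "\<dots> = (\<Sum>i\<in>I. c i *\<^sub>R unit_vec i)"
    using \<open>j \<in> I\<close> by (simp add: sum.remove[of I j])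
  finally have "norm (gamma (I, L) j - assignment_vec a I) = sqrt (\<Sum>i\<in>I. (c i)\<^sup>2)"
    by (simp only: norm_sum_scaled_axes)
  also have "(\<Sum>i\<in>I. (c i)\<^sup>2) = (c j)\<^sup>2 + (\<Sum>i\<in>I - {j}. (c i)\<^sup>2)"
    using \<open>j \<in> I\<close> by (simp add: sum.remove[of I j])
  also have "(c j)\<^sup>2 = 4 * of_bool (\<not> satisfies a (L j))"
    by (auto simp: c_def s_def truth_sign_def)
  also have "(\<Sum>i\<in>I - {j}. (c i)\<^sup>2) = (\<Sum>i\<in>I - {j}. 4 * of_bool (satisfies a (L i)))"
    by (intro sum.cong) (auto simp: c_def s_def truth_sign_def)
  also have "4 * of_bool (\<not> satisfies a (L j)) + (\<Sum>i\<in>I - {j}. 4 * of_bool (satisfies a (L i))) =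
      4 * (of_bool (\<not> satisfies a (L j)) + (\<Sum>i\<in>I - {j}. of_bool (satisfies a (L i)) :: real))"
    by (simp only: sum_distrib_left distrib_left)
  finally show ?thesis
    by (simp only: real_sqrt_mult real_sqrt_four)
qed

text \<open>With 0, 1, 2, 3 satisfied literals the cost is 6, 4 sqrt 2, 4 + 2 sqrt 3 and 6 sqrt 2,
  respectively.\<close>

lemma clause_sign_cost:
  fixes \<Psi> :: "'n::{finite,linorder} clause"
  assumes "is_3clause \<Psi>"
  shows "4 * sqrt 2 \<le> clause_sign_cost a \<Psi>"
    and "clause_sign_cost a \<Psi> = 4 * sqrt 2 \<longleftrightarrow> (\<exists>!i. i \<in> fst \<Psi> \<and> satisfies a (snd \<Psi> i))"
proof -
  from assms obtain x y z L where \<Psi>: "\<Psi> = ({x, y, z}, L)" and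
    ne: "x \<noteq> y" "x \<noteq> z" "y \<noteq> z" and L: "\<And>i. i \<in> {x, y, z} \<Longrightarrow> L i \<in> {Pos i, Neg i}"
    by (elim is_3clause_cases) blast
  define X Y Z where XYZ: "X = satisfies a (L x)" "Y = satisfies a (L y)" "Z = satisfies a (L z)"
  have diff: "{x, y, z} - {x} = {y, z}" "{x, y, z} - {y} = {x, z}" "{x, y, z} - {z} = {x, y}"
    using ne by auto
  note norm_eq = norm_gamma_diff_assignment_vec[of _ "{x, y, z}" L a, OF _ L]
  have cost: "clause_sign_cost a \<Psi> =
      2 * sqrt (of_bool (\<not> X) + of_bool Y + of_bool Z) +
      2 * sqrt (of_bool (\<not> Y) + of_bool X + of_bool Z) +
      2 * sqrt (of_bool (\<not> Z) + of_bool X + of_bool Y)"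
    using ne norm_eq[of x] norm_eq[of y] norm_eq[of z]
    by (simp add: \<Psi> clause_sign_cost_def diff XYZ add.assoc)
  have one: "(\<exists>!i. i \<in> fst \<Psi> \<and> satisfies a (snd \<Psi> i)) \<longleftrightarrow>
      (X \<and> \<not> Y \<and> \<not> Z) \<or> (\<not> X \<and> Y \<and> \<not> Z) \<or> (\<not> X \<and> \<not> Y \<and> Z)"
    using ne by (auto simp: \<Psi> XYZ)
  \<comment> \<open>This is what separates 4 sqrt 2 from 6, the cost with no satisfied
    literal.\<close>
  have less: "sqrt 2 < 3 / 2"
    by (rule real_less_lsqrt) (simp_all add: power2_eq_square)
  have gt: "1 < sqrt 2" "sqrt 2 < sqrt 3"
    by simp_all
  show "4 * sqrt 2 \<le> clause_sign_cost a \<Psi>"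
    unfolding cost using less gt
    by (cases X; cases Y; cases Z) (simp_all del: real_sqrt_less_iff real_sqrt_gt_1_iff)
  show "clause_sign_cost a \<Psi> = 4 * sqrt 2 \<longleftrightarrow> (\<exists>!i. i \<in> fst \<Psi> \<and> satisfies a (snd \<Psi> i))"
    unfolding cost one using less gt
    by (cases X; cases Y; cases Z) (simp_all del: real_sqrt_less_iff real_sqrt_gt_1_iff)
qed

section \<open>Rounding an orthogonal matrix to signs\<close>

text \<open>Here \<open>a\<close> and \<open>b\<close> stand for the distances of a unit vector from
  two antipodal unit vectors. The rate 1/2 is chosen because the weight 6 of the axis states turns
  it into the 3 needed for the three states \<gamma>_j.\<close>

lemma add_ge_of_sum_squares:
  fixes a b :: real
  assumes "0 \<le> a" "a \<le> b" "a\<^sup>2 + b\<^sup>2 = 4"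
  shows "2 + a / 2 \<le> a + b"
proof (rule ccontr)
  assume "\<not> ?thesis"
  then have b: "b < 2 - a / 2" by simp
  then have "b\<^sup>2 < (2 - a / 2)\<^sup>2"
    using assms by (intro power_strict_mono) auto
  then have "a * 8 < a * (a * 5)"
    using assms(3) by (simp add: power2_eq_square algebra_simps)
  \<comment> \<open>Now \<open>a\<close> exceeds 8/5, hence \<open>b\<close> is below 6/5, which
    contradicts \<open>a \<le> b\<close>.\<close>
  then have "8 < a * 5"
    using assms(1) by (meson mult_left_mono not_le)
  with b assms(2) show False by simp
qed

lemma axis_cost_ge:
  fixes M :: "real ^ 'n::finite ^ 'n"
  assumes "orthogonal_matrix M"
  shows "2 + norm (truth_sign (norm (unit_vec i - M *v unit_vec i) \<le>
    norm (unit_vec i + M *v unit_vec i)) *\<^sub>R unit_vec i - M *v unit_vec i) / 2 \<le> axis_cost M i"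
proof -
  define u w where "u = unit_vec i" "w = M *v unit_vec i"
  have "norm w = norm u"
    using assms orthogonal_transformation_matrix[of "(*v) M"]
    by (simp add: u_w_def orthogonal_transformation)
  then have "norm u = 1" "norm w = 1" by (simp_all add: u_w_def)
  \<comment> \<open>The parallelogram law for two unit vectors.\<close>
  then have sq: "(norm (u - w))\<^sup>2 + (norm (u + w))\<^sup>2 = 4"
    by (simp add: power2_norm_eq_inner inner_diff inner_add inner_commute norm_eq_1)
  show ?thesis
  proof (cases "norm (u - w) \<le> norm (u + w)")
    case True
    then show ?thesis
      using add_ge_of_sum_squares[of "norm (u - w)" "norm (u + w)"] sq
      by (simp add: axis_cost_def truth_sign_def u_w_def)
  next
    case False
    moreover have "norm (- u - w) = norm (u + w)"
      using norm_minus_cancel[of "u + w"] by simp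
    ultimately show ?thesis
      using add_ge_of_sum_squares[of "norm (u + w)" "norm (u - w)"] sq
      by (simp add: axis_cost_def truth_sign_def u_w_def)
  qed
qed

text \<open>The assignment \<open>a\<close> depends on \<open>M\<close> alone and not on the clause,
  so one assignment serves all clauses at once.\<close>

lemma clause_cost_ge:
  fixes \<Psi> :: "'n::{finite,linorder} clause"
  assumes "orthogonal_matrix M" "is_3clause \<Psi>"
  defines "a \<equiv> \<lambda>i. norm (unit_vec i - M *v unit_vec i) \<le> norm (unit_vec i + M *v unit_vec i)"
  shows "36 + clause_sign_cost a \<Psi> \<le> clause_cost M \<Psi>"
proof -
  obtain I L where \<Psi>: "\<Psi> = (I, L)" by (cases \<Psi>)
  have card: "card I = 3" using assms(2) by (simp add: \<Psi> is_3clause_def)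
  define r where "r i = norm (truth_sign (a i) *\<^sub>R unit_vec i - M *v unit_vec i)" for i
  have "norm (assignment_vec a I - M *v (\<Sum>i\<in>I. unit_vec i)) =
      norm (\<Sum>i\<in>I. truth_sign (a i) *\<^sub>R unit_vec i - M *v unit_vec i)"
    by (simp add: assignment_vec_def linear_sum[OF matrix_vector_mul_linear] sum_subtractf)
  also have "\<dots> \<le> (\<Sum>i\<in>I. r i)"
    unfolding r_def by (rule norm_sum)
  finally have round: "norm (assignment_vec a I - M *v (\<Sum>i\<in>I. unit_vec i)) \<le> (\<Sum>i\<in>I. r i)" .
  have "norm (gamma (I, L) j - assignment_vec a I) \<le>
      norm (gamma (I, L) j - M *v (\<Sum>i\<in>I. unit_vec i)) + (\<Sum>i\<in>I. r i)" for j
    using round by norm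
  then have "clause_sign_cost a \<Psi> \<le>
      (\<Sum>j\<in>I. norm (gamma (I, L) j - M *v (\<Sum>i\<in>I. unit_vec i)) + (\<Sum>i\<in>I. r i))"
    unfolding clause_sign_cost_def \<Psi> by (simp add: sum_mono)
  then have 1: "clause_sign_cost a \<Psi> \<le>
      (\<Sum>j\<in>I. norm (gamma (I, L) j - M *v (\<Sum>i\<in>I. unit_vec i))) + 3 * (\<Sum>i\<in>I. r i)"
    by (simp add: sum.distrib card)
  have "(\<Sum>i\<in>I. 2 + r i / 2) \<le> (\<Sum>i\<in>I. axis_cost M i)"
    unfolding r_def a_def by (intro sum_mono axis_cost_ge assms)
  \<comment> \<open>The surplus 3 \<open>r i\<close> per variable cancels exactly the rounding loss
    in fact \<open>1\<close>.\<close>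
  then have "36 + 3 * (\<Sum>i\<in>I. r i) \<le> 6 * (\<Sum>i\<in>I. axis_cost M i)"
    by (simp add: sum.distrib card flip: sum_divide_distrib)
  with 1 show ?thesis by (simp add: clause_cost_def \<Psi>)
qed

definition sign_matrix :: "('n \<Rightarrow> bool) \<Rightarrow> real ^ 'n ^ 'n::finite" where
  "sign_matrix a = (\<chi> i j. if i = j then truth_sign (a i) else 0)"

lemma orthogonal_sign_matrix: "orthogonal_matrix (sign_matrix a)"
  unfolding orthogonal_matrix
  by (auto simp: sign_matrix_def matrix_matrix_mult_def transpose_def mat_def vec_eq_iff
      truth_sign_def if_distrib[of "\<lambda>x. _ * x"] if_distrib[of "\<lambda>x. x * _"] cong: if_cong)

lemma sign_matrix_unit_vec: "sign_matrix a *v unit_vec i = truth_sign (a i) *\<^sub>R unit_vec i"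
  by (simp add: sign_matrix_def matrix_vector_mult_basis column_def vec_eq_iff)
    (simp add: axis_def)

text \<open>Rounding is exact here: e_i goes to itself or its negative, so one of its two axis
  distances is 0 and the other 2, and the three variables contribute 6 * 3 * 2 = 36.\<close>

lemma clause_cost_sign_matrix:
  assumes "is_3clause \<Psi>"
  shows "clause_cost (sign_matrix a) \<Psi> = 36 + clause_sign_cost a \<Psi>"
proof -
  obtain I L where \<Psi>: "\<Psi> = (I, L)" by (cases \<Psi>)
  have card: "card I = 3" using assms by (simp add: \<Psi> is_3clause_def)
  have "axis_cost (sign_matrix a) i = 2" for i
  proof -
    have "norm (unit_vec i + unit_vec i) = 2"
      using norm_scaleR[of 2 "unit_vec i"] by (simp add: scaleR_2)
    then show ?thesis
      by (simp add: axis_cost_def sign_matrix_unit_vec truth_sign_def)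
  qed
  then show ?thesis
    by (simp add: \<Psi> clause_cost_def clause_sign_cost_def assignment_vec_def card
        linear_sum[OF matrix_vector_mul_linear] sign_matrix_unit_vec)
qed

section \<open>From single clauses to the whole formula\<close>

lemma one_in_three_model_iff:
  fixes \<Phi> :: "'n::{finite,linorder} cnf"
  assumes "is_3cnf \<Phi>"
  shows "one_in_three_model a \<Phi> \<longleftrightarrow> (\<forall>\<Psi>\<in>set \<Phi>. clause_sign_cost a \<Psi> = 4 * sqrt 2)"
  using assms by (simp add: one_in_three_model_def is_3cnf_def clause_sign_cost(2) case_prod_beta)

text \<open>The second part transfers tightness of the total to every clause.\<close>

lemma sum_list_ge_const:
  fixes f :: "'a \<Rightarrow> real"
  assumes "\<And>x. x \<in> set xs \<Longrightarrow> c \<le> f x"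
  shows "real (length xs) * c \<le> (\<Sum>x\<leftarrow>xs. f x)"
    and "(\<Sum>x\<leftarrow>xs. f x) \<le> real (length xs) * c \<Longrightarrow> \<forall>x\<in>set xs. f x = c"
proof -
  have "real (length xs) * c \<le> (\<Sum>x\<leftarrow>xs. f x) \<and>
    ((\<Sum>x\<leftarrow>xs. f x) \<le> real (length xs) * c \<longrightarrow> (\<forall>x\<in>set xs. f x = c))"
    using assms
  proof (induction xs)
    case (Cons x xs)
    then have "c \<le> f x" "real (length xs) * c \<le> (\<Sum>x\<leftarrow>xs. f x)"
      "(\<Sum>x\<leftarrow>xs. f x) \<le> real (length xs) * c \<longrightarrow> (\<forall>x\<in>set xs. f x = c)"
      by auto
    then show ?case by (auto simp: algebra_simps)
  qed simp
  then show "real (length xs) * c \<le> (\<Sum>x\<leftarrow>xs. f x)"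
    "(\<Sum>x\<leftarrow>xs. f x) \<le> real (length xs) * c \<Longrightarrow> \<forall>x\<in>set xs. f x = c"
    by blast+
qed

theorem theorem2:
  fixes \<Phi> :: "'n::{finite,linorder} cnf" and m :: nat
  assumes "is_3cnf \<Phi>" and "length \<Phi> = m" and "m \<ge> 1"
  shows "(\<exists>a. one_in_three_model a \<Phi>) \<longleftrightarrow>
    d1C (formula_S_bar \<Phi>) (formula_T_bar \<Phi>) = real m * (72 + 8 * sqrt 2)"
proof -
  \<comment> \<open>Half of the claimed value per clause, since the negated copy doubles every
    cost.\<close>
  let ?c = "36 + 4 * sqrt 2"
  have clause: "is_3clause \<Psi>" if "\<Psi> \<in> set \<Phi>" for \<Psi>
    using assms(1) that by (simp add: is_3cnf_def)
  have "length (formula_S_bar \<Phi>) = length (formula_T_bar \<Phi>)"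
    using length_formula_bar[OF assms(1)] by simp
  then obtain M v where M: "orthogonal_matrix M"
    and min: "d1C (formula_S_bar \<Phi>) (formula_T_bar \<Phi>) =
      d1 (formula_S_bar \<Phi>) (congruent_image M v (formula_T_bar \<Phi>))"
    by (rule d1C_attained)
  \<comment> \<open>The rounding of a minimising \<open>M\<close>; it turns out to be a model when
    the minimum has the claimed value.\<close>
  define a where
    "a i \<longleftrightarrow> norm (unit_vec i - M *v unit_vec i) \<le> norm (unit_vec i + M *v unit_vec i)" for i
  have sign: "36 + clause_sign_cost a \<Psi> \<le> clause_cost M \<Psi>" if "\<Psi> \<in> set \<Phi>" for \<Psi>
    using clause_cost_ge[OF M clause[OF that]] by (simp add: a_def[abs_def])
  have lower: "2 * (\<Sum>\<Psi>\<leftarrow>\<Phi>. clause_cost M \<Psi>) \<le> d1C (formula_S_bar \<Phi>) (formula_T_bar \<Phi>)"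
    using d1_symmetrized_ge[OF length_formula_S_T[OF assms(1)], of M v]
    unfolding min by (simp add: formula_S_bar_def formula_T_bar_def d1_formula[OF assms(1)])
  have ge: "?c \<le> clause_cost M \<Psi>" if "\<Psi> \<in> set \<Phi>" for \<Psi>
    using sign[OF that] clause_sign_cost(1)[OF clause[OF that], of a] by linarith
  note sums = sum_list_ge_const[of \<Phi> ?c "clause_cost M", OF ge]
  show ?thesis
  proof
    assume "\<exists>b. one_in_three_model b \<Phi>"
    then obtain b where "one_in_three_model b \<Phi>" ..
    then have "clause_cost (sign_matrix b) \<Psi> = ?c" if "\<Psi> \<in> set \<Phi>" for \<Psi>
      using that by (simp add: one_in_three_model_iff[OF assms(1)] clause_cost_sign_matrix clause)
    then have "(\<Sum>\<Psi>\<leftarrow>\<Phi>. clause_cost (sign_matrix b) \<Psi>) = (\<Sum>\<Psi>\<leftarrow>\<Phi>. ?c)"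
      by (intro arg_cong[where f = sum_list] map_cong) auto
    \<comment> \<open>The sign matrix of the model, with translation zero, is a competitor in the
      minimum.\<close>
    then have "d1C (formula_S_bar \<Phi>) (formula_T_bar \<Phi>) \<le> 2 * (real m * ?c)"
      using d1C_le[OF orthogonal_sign_matrix, of "formula_S_bar \<Phi>" "formula_T_bar \<Phi>" b 0]
        d1_symmetrized_eq[OF length_formula_S_T[OF assms(1)], of "sign_matrix b"]
      by (simp add: formula_S_bar_def formula_T_bar_def d1_formula[OF assms(1)] sum_list_triv assms(2))
    with lower sums(1) show "d1C (formula_S_bar \<Phi>) (formula_T_bar \<Phi>) = real m * (72 + 8 * sqrt 2)"
      by (simp add: assms(2) algebra_simps)
  next
    assume "d1C (formula_S_bar \<Phi>) (formula_T_bar \<Phi>) = real m * (72 + 8 * sqrt 2)"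
    with lower have "(\<Sum>\<Psi>\<leftarrow>\<Phi>. clause_cost M \<Psi>) \<le> real (length \<Phi>) * ?c"
      by (simp add: assms(2) algebra_simps)
    then have "\<forall>\<Psi>\<in>set \<Phi>. clause_cost M \<Psi> = ?c"
      using sums(2) by blast
    \<comment> \<open>The sign cost lies between 4 sqrt 2 and
      \<open>clause_cost M \<Psi> - 36\<close>, which are now equal.\<close>
    then have "clause_sign_cost a \<Psi> = 4 * sqrt 2" if "\<Psi> \<in> set \<Phi>" for \<Psi>
      using that sign[OF that] clause_sign_cost(1)[OF clause[OF that], of a] by force
    then show "\<exists>a. one_in_three_model a \<Phi>"
      using one_in_three_model_iff[OF assms(1)] by blast
  qed
qed

end
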